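(* Let $k=2K+1\geq 5$ be an odd integer and let $\mathcal C$ be the $(K-1)\times(K-1)$ matrix with entries $$\mathcal C_{s,r}=\binom{2K-2s}{2r-1}+\binom{2K-2s}{2K-2r}\qquad(1\le s,r\le K-1).$$ Then $\mathcal C$ is invertible and for all $1\le r,s\le K-1$, $$\big(\mathcal C^{-1}\big)_{r,s}=\frac{-2}{2s-1}\sum_{n=0}^{k-2s}\binom{k-2r-1}{k-2s-n}\binom{n+2s-2}{n}B_n=\frac{2}{2s-1}\sum_{n=0}^{k-2s}\binom{2r-1}{k-2s-n}\binom{n+2s-2}{n}B_n .$$
   Context: $B_n$ denotes the $n$th Bernoulli number, defined by $\frac{t}{e^t-1}=\sum_{n\ge0}B_n\frac{t^n}{n!}$ (so $B_0=1$, $B_1=-\tfrac12$, $B_2=\tfrac16$). Binomial coefficients $\binom{a}{m}$ with $a\ge 0$ are the usual ones, equal to $0$ when $m<0$ or $m>a$. The matrix $\mathcal C$ is the transpose of the matrix $\mathcal A$ whose $(r,s)$-entry is $\binom{2K-2s}{2r-1}+\binom{2K-2s}{2K-2r}$, the coefficient matrix appearing in Zagier's expression of double zeta values $\zeta(2r,k-2r)$ modulo $\mathbb{Q}\zeta(k)$ in terms of products $\zeta(2s)\zeta(k-2s)$. *)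

theory Defs
  imports
    "HOL-Computational_Algebra.Formal_Power_Series"
    "Jordan_Normal_Form.Matrix"
begin

definition bernoulli :: "nat \<Rightarrow> rat" where
  "bernoulli n = fact n * fps_nth (fps_X / (fps_exp 1 - 1)) n"

text \<open>The division of formal power series above is exact.\<close>

lemma bernoulli_gen_fun:
  "Abs_fps (\<lambda>n. bernoulli n / fact n) * (fps_exp 1 - 1) = fps_X"
proof -
  let ?E = "fps_exp 1 - 1 :: rat fps"
  have nz: "?E \<noteq> 0"
  proof
    assume "?E = 0"
    then have "fps_nth ?E 1 = 0" by simp
    then show False by simp
  qed
  have "subdegree ?E = 1"
    by (rule subdegreeI) simp_all
  then have "?E dvd fps_X"
    using nz by (simp add: fps_dvd_iff)
  moreover have "Abs_fps (\<lambda>n. bernoulli n / fact n) = fps_X / ?E"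
    by (simp add: fps_eq_iff bernoulli_def)
  ultimately show ?thesis by simp
qed

text \<open>
  Matrices are indexed from 0, so the entry in row \<open>s\<close> and column \<open>r\<close>
  (\<open>1 \<le> s, r \<le> K - 1\<close>) sits at position \<open>(s - 1, r - 1)\<close>.
\<close>

definition C_mat :: "nat \<Rightarrow> rat mat" where
  "C_mat K = mat (K - 1) (K - 1) (\<lambda>(i, j). let s = i + 1; r = j + 1 in
     of_nat ((2 * K - 2 * s) choose (2 * r - 1)) +
     of_nat ((2 * K - 2 * s) choose (2 * K - 2 * r)))"

end

theory Submission
  imports Defs "Jordan_Normal_Form.Determinant"
begin

text \<open>
  The binomial transform \<open>a\<^sub>n \<mapsto> \<Sum>\<^sub>j (n choose j) a\<^sub>j\<close> multiplies exponential generating functions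
  by \<open>exp t\<close>. As \<open>B(t) exp t = B(-t)\<close> for the Bernoulli numbers, it maps \<open>B\<^sub>n\<close> to
  \<open>(-1)\<^sup>n B\<^sub>n\<close>. Multiplying their generating function by \<open>t\<^sup>q / q!\<close> yields the sequence
  \<open>c\<^sub>n = (n choose q) B\<^sub>n\<^sub>-\<^sub>q\<close>, for which the same relation holds if \<open>q\<close> is even.

  With \<open>d = 2 K - 1\<close> and \<open>q = 2 s - 2\<close>, the sum in the second formula for the entry \<open>(r, s)\<close> is
  \<open>\<phi> (2 r - 1)\<close>, where \<open>\<phi>\<close> is the binomial transform of the reversed sequence
  \<open>j \<mapsto> c\<^sub>d\<^sub>-\<^sub>j\<close>. Pascal's rule turns the relation for \<open>c\<close> into \<open>\<phi> (d - m) = - \<phi> m\<close>, so the two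
  formulas agree, and the product of row \<open>s'\<close> of the matrix with column \<open>s\<close> of the claimed
  inverse becomes, up to a constant factor, the alternating sum of \<open>(N choose m) \<phi> m\<close> for
  \<open>N = 2 K - 2 s'\<close>. Binomial inversion evaluates it to \<open>c\<^sub>d\<^sub>-\<^sub>N\<close>, a multiple of the Bernoulli
  number of index \<open>2 (s' - s) + 1\<close>, which vanishes unless \<open>s' = s\<close>.
\<close>

definition binomial_transform :: "(nat \<Rightarrow> 'a :: semiring_1) \<Rightarrow> nat \<Rightarrow> 'a" where
  "binomial_transform a n = (\<Sum>j\<le>n. of_nat (n choose j) * a j)"

lemma binomial_transform_0 [simp]: "binomial_transform a 0 = a 0"
  by (simp add: binomial_transform_def)

lemma binomial_transform_diff:
  fixes a b :: "nat \<Rightarrow> 'a :: ring_1"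
  shows "binomial_transform (\<lambda>j. a j - b j) n = binomial_transform a n - binomial_transform b n"
  by (simp add: binomial_transform_def right_diff_distrib sum_subtractf)

lemma binomial_transform_uminus:
  fixes a :: "nat \<Rightarrow> 'a :: ring_1"
  shows "binomial_transform (\<lambda>j. - a j) n = - binomial_transform a n"
  by (simp add: binomial_transform_def sum_negf)

lemma binomial_transform_extend:
  assumes "n \<le> N"
  shows "binomial_transform a n = (\<Sum>j\<le>N. of_nat (n choose j) * a j)"
  unfolding binomial_transform_def
  using assms by (intro sum.mono_neutral_left) (auto simp: binomial_eq_0)

lemma binomial_transform_Suc:
  "binomial_transform a (Suc n) = binomial_transform a n + binomial_transform (\<lambda>j. a (Suc j)) n"
proof -
  have "binomial_transform a (Suc n)
      = a 0 + (\<Sum>j\<le>n. of_nat (n choose Suc j) * a (Suc j) + of_nat (n choose j) * a (Suc j))"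
    by (simp add: binomial_transform_def sum.atMost_Suc_shift distrib_right add.commute
        del: sum.atMost_Suc)
  also have "\<dots> = (\<Sum>j\<le>Suc n. of_nat (n choose j) * a j) + binomial_transform (\<lambda>j. a (Suc j)) n"
    by (simp add: binomial_transform_def sum.atMost_Suc_shift sum.distrib add.assoc
        del: sum.atMost_Suc)
  finally show ?thesis
    by (simp only: binomial_transform_extend [of n "Suc n" a])
qed

lemma binomial_transform_involution:
  fixes a :: "nat \<Rightarrow> 'a :: ring_1"
  shows "binomial_transform (\<lambda>m. (-1) ^ m * binomial_transform a m) n = (-1) ^ n * a n"
proof (induction n arbitrary: a)
  case 0
  show ?case by simp
next
  case (Suc n)
  then show ?case
    by (simp add: binomial_transform_Suc [of _ n] binomial_transform_Suc [of a]
        distrib_left binomial_transform_diff binomial_transform_uminus)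
qed

lemma binomial_transform_rev_self:
  "binomial_transform (\<lambda>j. a (n - j)) n = binomial_transform a n"
  unfolding binomial_transform_def
  by (rule sum.reindex_bij_witness [of _ "\<lambda>j. n - j" "\<lambda>j. n - j"])
     (auto simp flip: binomial_symmetric)

lemma binomial_transform_rev_reflect:
  fixes b :: "nat \<Rightarrow> 'a :: comm_ring_1"
  assumes eigen: "\<And>n. binomial_transform b n = c * (-1) ^ n * b n" and "m \<le> d"
  shows "binomial_transform (\<lambda>j. b (d - j)) (d - m)
    = c * (-1) ^ d * binomial_transform (\<lambda>j. b (d - j)) m"
  using \<open>m \<le> d\<close>
proof (induction m arbitrary: d)
  case 0
  show ?case
    by (simp add: binomial_transform_rev_self eigen)
next
  case (Suc m)
  then obtain e where d: "d = Suc e" "m \<le> e"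
    by (cases d) auto
  let ?\<phi> = "\<lambda>d. binomial_transform (\<lambda>j. b (d - j))"
  have pascal: "?\<phi> d (Suc l) = ?\<phi> d l + ?\<phi> e l" for l
    by (simp add: d binomial_transform_Suc)
  have "?\<phi> d (d - m) = ?\<phi> d (d - Suc m) + ?\<phi> e (e - m)"
    using d pascal [of "e - m"] by (simp add: Suc_diff_le)
  then have "?\<phi> d (d - Suc m) = c * (-1) ^ d * ?\<phi> d m - c * (-1) ^ e * ?\<phi> e m"
    using Suc.IH [of d] Suc.IH [of e] d by (simp add: eq_diff_eq)
  also have "\<dots> = c * (-1) ^ d * ?\<phi> d (Suc m)"
    unfolding pascal by (simp add: d algebra_simps)
  finally show ?case .
qed

definition binomial_shift :: "nat \<Rightarrow> (nat \<Rightarrow> 'a :: semiring_1) \<Rightarrow> nat \<Rightarrow> 'a" where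
  "binomial_shift q b n = of_nat (n choose q) * b (n - q)"

lemma binomial_transform_binomial_shift:
  fixes b :: "nat \<Rightarrow> 'a :: comm_semiring_1"
  shows "binomial_transform (binomial_shift q b) n = binomial_shift q (binomial_transform b) n"
proof (cases "q \<le> n")
  case True
  have "binomial_transform (binomial_shift q b) n
      = (\<Sum>i\<in>{q..n}. of_nat (n choose i) * (of_nat (i choose q) * b (i - q)))"
    unfolding binomial_transform_def binomial_shift_def
    by (rule sum.mono_neutral_right) (auto simp: binomial_eq_0)
  also have "\<dots> = (\<Sum>i\<in>{q..n}. of_nat (n choose q) * (of_nat ((n - q) choose (i - q)) * b (i - q)))"
    by (rule sum.cong) (simp_all add: choose_mult flip: mult.assoc of_nat_mult)
  also have "\<dots> = (\<Sum>j\<le>n - q. of_nat (n choose q) * (of_nat ((n - q) choose j) * b j))"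
    by (rule sum.reindex_bij_witness [of _ "\<lambda>j. j + q" "\<lambda>i. i - q"]) (use True in auto)
  finally show ?thesis
    by (simp add: binomial_shift_def binomial_transform_def sum_distrib_left)
next
  case False
  then show ?thesis
    by (simp add: binomial_transform_def binomial_shift_def binomial_eq_0)
qed

lemma binomial_transform_binomial_shift_eigen:
  fixes b :: "nat \<Rightarrow> 'a :: comm_ring_1"
  assumes eigen: "\<And>n. binomial_transform b n = c * (-1) ^ n * b n"
  shows "binomial_transform (binomial_shift q b) n = c * (-1) ^ q * (-1) ^ n * binomial_shift q b n"
proof (cases "q \<le> n")
  case True
  then have "(-1) ^ q * (-1) ^ n = ((-1) ^ (n - q) :: 'a)"
    by (metis le_add_diff_inverse left_minus_one_mult_self power_add)
  then show ?thesis
    by (simp add: binomial_transform_binomial_shift binomial_shift_def eigen mult_ac)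
next
  case False
  then show ?thesis
    by (simp add: binomial_transform_binomial_shift binomial_shift_def binomial_eq_0)
qed

lemma binomial_transform_rev_binomial_shift:
  fixes b :: "nat \<Rightarrow> 'a :: comm_semiring_1"
  assumes "m \<le> d" "q \<le> d"
  shows "binomial_transform (\<lambda>j. binomial_shift q b (d - j)) m
    = (\<Sum>n = 0..d - q. of_nat (m choose (d - q - n)) * of_nat ((n + q) choose n) * b n)"
proof -
  have "binomial_transform (\<lambda>j. binomial_shift q b (d - j)) m
      = (\<Sum>j\<le>d - q. of_nat (m choose j) * binomial_shift q b (d - j))"
    unfolding binomial_transform_extend [OF \<open>m \<le> d\<close>]
  proof (intro sum.mono_neutral_right ballI)
    fix j assume "j \<in> {..d} - {..d - q}"
    then have "d - j < q" by auto
    then show "of_nat (m choose j) * binomial_shift q b (d - j) = 0"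
      by (simp add: binomial_shift_def binomial_eq_0)
  qed auto
  also have "\<dots> = (\<Sum>n = 0..d - q. of_nat (m choose (d - q - n)) * binomial_shift q b (n + q))"
    by (rule sum.reindex_bij_witness [of _ "\<lambda>n. d - q - n" "\<lambda>j. d - q - j"]) (use assms in auto)
  also have "\<dots> = (\<Sum>n = 0..d - q. of_nat (m choose (d - q - n)) * of_nat ((n + q) choose n) * b n)"
    by (simp add: binomial_shift_def binomial_symmetric [of q] mult.assoc)
  finally show ?thesis .
qed

lemma sum_atMost_double_odd_even_rev:
  fixes f :: "nat \<Rightarrow> 'a :: comm_monoid_add"
  shows "(\<Sum>m\<le>2 * M. f m) = f 0 + (\<Sum>i<M. f (2 * i + 1) + f (2 * M - 2 * i))"
proof -
  have "(\<Sum>m\<le>2 * M. f m) = f 0 + (\<Sum>i<M. f (2 * i + 1)) + (\<Sum>i<M. f (2 * Suc i))"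
    by (induction M) (simp_all add: ac_simps)
  also have "(\<Sum>i<M. f (2 * Suc i)) = (\<Sum>i<M. f (2 * M - 2 * i))"
    by (rule sum.reindex_bij_witness [of _ "\<lambda>i. M - Suc i" "\<lambda>i. M - Suc i"])
       (auto simp: algebra_simps)
  finally show ?thesis
    by (simp add: sum.distrib add.assoc)
qed

lemma binomial_transform_alternating_antisymmetric:
  fixes \<phi> :: "nat \<Rightarrow> 'a :: comm_ring_1"
  assumes antisym: "\<And>m. m \<le> 2 * M \<Longrightarrow> \<phi> (2 * M + 1 - m) = - \<phi> m" and "\<phi> 0 = 0" and "N \<le> 2 * M"
  shows "binomial_transform (\<lambda>m. (-1) ^ m * \<phi> m) N =
    - (\<Sum>i<M. of_nat ((N choose (2 * i + 1)) + (N choose (2 * M - 2 * i))) * \<phi> (2 * i + 1))"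
proof -
  let ?f = "\<lambda>m. of_nat (N choose m) * ((-1) ^ m * \<phi> m)"
  have pair: "?f (2 * i + 1) + ?f (2 * M - 2 * i) =
      - (of_nat ((N choose (2 * i + 1)) + (N choose (2 * M - 2 * i))) * \<phi> (2 * i + 1))"
    if "i < M" for i
  proof -
    have "\<phi> (2 * M - 2 * i) = - \<phi> (2 * i + 1)"
      using antisym [of "2 * i + 1"] that by simp
    moreover have "even (2 * M - 2 * i)"
      by simp
    ultimately show ?thesis
      by (simp add: distrib_right)
  qed
  have "binomial_transform (\<lambda>m. (-1) ^ m * \<phi> m) N = (\<Sum>m\<le>2 * M. ?f m)"
    by (rule binomial_transform_extend [OF \<open>N \<le> 2 * M\<close>])
  also have "\<dots> = (\<Sum>i<M. ?f (2 * i + 1) + ?f (2 * M - 2 * i))"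
    using \<open>\<phi> 0 = 0\<close> by (simp add: sum_atMost_double_odd_even_rev)
  also have "\<dots> = (\<Sum>i<M. - (of_nat ((N choose (2 * i + 1)) + (N choose (2 * M - 2 * i)))
      * \<phi> (2 * i + 1)))"
    by (rule sum.cong) (simp_all only: pair lessThan_iff)
  finally show ?thesis
    by (simp only: sum_negf)
qed

definition egf :: "(nat \<Rightarrow> 'a :: field_char_0) \<Rightarrow> 'a fps" where
  "egf a = Abs_fps (\<lambda>n. a n / fact n)"

lemma fps_nth_egf [simp]: "fps_nth (egf a) n = a n / fact n"
  by (simp add: egf_def)

lemma egf_inject: "egf a = egf b \<longleftrightarrow> a = b"
  by (auto simp: fps_eq_iff)

lemma egf_binomial_transform: "egf (binomial_transform a) = egf a * fps_exp 1"
  by (simp add: fps_eq_iff fps_mult_nth binomial_transform_def atMost_atLeast0 sum_divide_distrib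
      binomial_fact)

lemma egf_alternating: "egf (\<lambda>n. (-1) ^ n * a n) = egf a oo (- fps_X)"
  by (simp add: fps_eq_iff fps_compose_uminus')

lemma egf_bernoulli: "egf bernoulli * (fps_exp 1 - 1) = fps_X"
  unfolding egf_def by (rule bernoulli_gen_fun)

lemma egf_bernoulli_reflect: "egf bernoulli oo (- fps_X) = egf bernoulli * fps_exp 1"
proof -
  let ?B = "egf bernoulli" and ?E = "fps_exp 1 :: rat fps" and ?E' = "fps_exp (-1) :: rat fps"
  have "?E oo (- fps_X) = ?E'"
    by (simp add: fps_compose_uminus' fps_eq_iff)
  then have reflected: "(?B oo (- fps_X)) * (?E' - 1) = - fps_X"
    using arg_cong [OF egf_bernoulli, of "\<lambda>f. f oo (- fps_X)"]
    by (simp add: fps_compose_mult_distrib fps_compose_sub_distrib fps_X_fps_compose_startby0)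
  have "?E' * ?E = 1"
    by (simp flip: fps_exp_add_mult)
  then have "(?B oo (- fps_X)) * (?E - 1) = - ((?B oo (- fps_X)) * (?E' - 1)) * ?E"
    by (simp add: algebra_simps)
  also have "\<dots> = fps_X * ?E"
    by (simp add: reflected)
  also have "\<dots> = ?B * (?E - 1) * ?E"
    by (simp only: egf_bernoulli)
  finally have "(?B oo (- fps_X)) * (?E - 1) = ?B * ?E * (?E - 1)"
    by (simp only: mult_ac)
  then show ?thesis
    using egf_bernoulli by (metis fps_X_neq_zero mult_cancel_right mult_zero_right)
qed

lemma binomial_transform_bernoulli: "binomial_transform bernoulli n = (-1) ^ n * bernoulli n"
proof -
  have "egf (binomial_transform bernoulli) = egf (\<lambda>n. (-1) ^ n * bernoulli n)"
    by (simp only: egf_binomial_transform egf_alternating egf_bernoulli_reflect)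
  then show ?thesis
    by (simp add: egf_inject)
qed

lemma bernoulli_parity: "(-1) ^ n * bernoulli n = bernoulli n + (if n = 1 then 1 else 0)"
proof -
  have "egf (binomial_transform bernoulli) = egf bernoulli + fps_X"
    using egf_bernoulli by (simp add: egf_binomial_transform algebra_simps)
  then have "fps_nth (egf (binomial_transform bernoulli)) n = fps_nth (egf bernoulli + fps_X) n"
    by (rule arg_cong)
  then show ?thesis
    by (simp add: binomial_transform_bernoulli field_simps split: if_splits)
qed

lemma bernoulli_1: "bernoulli 1 = - 1 / 2"
  using bernoulli_parity [of 1] by simp

lemma bernoulli_odd_eq_0: "odd n \<Longrightarrow> n \<noteq> 1 \<Longrightarrow> bernoulli n = 0"
  using bernoulli_parity [of n] by simp

definition bernoulli_conv :: "nat \<Rightarrow> nat \<Rightarrow> nat \<Rightarrow> rat" where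
  "bernoulli_conv d q = binomial_transform (\<lambda>j. binomial_shift q bernoulli (d - j))"

lemma bernoulli_conv_eq_sum:
  assumes "m \<le> d" "q \<le> d"
  shows "bernoulli_conv d q m =
    (\<Sum>n = 0..d - q. of_nat (m choose (d - q - n)) * of_nat ((n + q) choose n) * bernoulli n)"
  unfolding bernoulli_conv_def by (rule binomial_transform_rev_binomial_shift [OF assms])

lemma bernoulli_conv_reflect:
  assumes "odd d" "even q" "m \<le> d"
  shows "bernoulli_conv d q (d - m) = - bernoulli_conv d q m"
proof -
  have "binomial_transform (binomial_shift q bernoulli) n
      = 1 * (-1) ^ q * (-1) ^ n * binomial_shift q bernoulli n" for n
    by (rule binomial_transform_binomial_shift_eigen) (simp add: binomial_transform_bernoulli)
  from binomial_transform_rev_reflect [OF this \<open>m \<le> d\<close>] show ?thesis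
    using assms by (simp add: bernoulli_conv_def)
qed

lemma bernoulli_conv_0_eq_0:
  assumes "odd d" "even q" "q + 1 < d"
  shows "bernoulli_conv d q 0 = 0"
  using assms by (simp add: bernoulli_conv_def binomial_shift_def bernoulli_odd_eq_0)

lemma binomial_transform_alternating_bernoulli_conv:
  "binomial_transform (\<lambda>m. (-1) ^ m * bernoulli_conv d q m) N
    = (-1) ^ N * binomial_shift q bernoulli (d - N)"
  unfolding bernoulli_conv_def by (rule binomial_transform_involution)

lemma binomial_shift_bernoulli_even_odd:
  "binomial_shift (2 * j) bernoulli (2 * i + 1) = (if i = j then - (of_nat (2 * j + 1) / 2) else 0)"
proof (cases i j rule: linorder_cases)
  case less
  then show ?thesis
    by (simp add: binomial_shift_def binomial_eq_0)
next
  case equal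
  then show ?thesis
    by (simp add: binomial_shift_def bernoulli_1 [simplified] field_simps)
next
  case greater
  then have "odd (2 * i + 1 - 2 * j)" "2 * i + 1 - 2 * j \<noteq> 1"
    by auto
  with greater show ?thesis
    by (simp add: binomial_shift_def bernoulli_odd_eq_0 del: One_nat_def)
qed

lemma bernoulli_conv_orthogonality:
  assumes "i < M" "j < M"
  shows "(\<Sum>l<M.
      of_nat (((2 * M - 2 * i) choose (2 * l + 1)) + ((2 * M - 2 * i) choose (2 * M - 2 * l)))
      * bernoulli_conv (2 * M + 1) (2 * j) (2 * l + 1))
    = (if i = j then of_nat (2 * j + 1) / 2 else 0)"
    (is "?lhs = _")
proof -
  let ?N = "2 * M - 2 * i" and ?\<phi> = "bernoulli_conv (2 * M + 1) (2 * j)"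
  have "?lhs = - binomial_transform (\<lambda>m. (-1) ^ m * ?\<phi> m) ?N"
    using assms by (subst binomial_transform_alternating_antisymmetric [where M = M])
      (simp_all add: bernoulli_conv_reflect bernoulli_conv_0_eq_0)
  also have "\<dots> = - ((-1) ^ ?N * binomial_shift (2 * j) bernoulli (2 * M + 1 - ?N))"
    by (simp only: binomial_transform_alternating_bernoulli_conv)
  also have "2 * M + 1 - ?N = 2 * i + 1"
    using assms by simp
  also have "- ((-1) ^ ?N * binomial_shift (2 * j) bernoulli (2 * i + 1))
      = (if i = j then of_nat (2 * j + 1) / 2 else 0)"
    unfolding binomial_shift_bernoulli_even_odd by simp
  finally show ?thesis .
qed

lemma inverts_mat_unique:
  fixes A :: "'a :: semiring_1 mat"
  assumes A: "A \<in> carrier_mat n n" and B: "B \<in> carrier_mat n n"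
    and BA: "inverts_mat B A" and AD: "inverts_mat A D" and DA: "inverts_mat D A"
  shows "D = B"
proof -
  have "dim_row D = n"
    using DA A by (metis carrier_matD(2) index_mult_mat(3) index_one_mat(3) inverts_mat_def)
  moreover have "dim_col D = n"
    using AD A by (metis carrier_matD(1) index_mult_mat(3) index_one_mat(3) inverts_mat_def)
  ultimately have D: "D \<in> carrier_mat n n"
    by auto
  have "D = (B * A) * D"
    using BA B D by (simp add: inverts_mat_def)
  also have "\<dots> = B * (A * D)"
    by (rule assoc_mult_mat [OF B A D])
  also have "\<dots> = B"
    using AD A B by (simp add: inverts_mat_def)
  finally show ?thesis .
qed

definition C_mat_inv :: "nat \<Rightarrow> rat mat" where
  "C_mat_inv K = mat (K - 1) (K - 1) (\<lambda>(i, j).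
     2 / of_nat (2 * j + 1) * bernoulli_conv (2 * K - 1) (2 * j) (2 * i + 1))"

lemma C_mat_carrier: "C_mat K \<in> carrier_mat (K - 1) (K - 1)"
  by (simp add: C_mat_def)

lemma C_mat_inv_carrier: "C_mat_inv K \<in> carrier_mat (K - 1) (K - 1)"
  by (simp add: C_mat_inv_def)

lemma C_mat_mult_C_mat_inv: "C_mat K * C_mat_inv K = 1\<^sub>m (K - 1)"
proof (rule eq_matI)
  fix i j assume "i < dim_row (1\<^sub>m (K - 1) :: rat mat)" "j < dim_col (1\<^sub>m (K - 1) :: rat mat)"
  then have ij: "i < K - 1" "j < K - 1" by auto
  then obtain M where K: "K = Suc M"
    by (cases K) auto
  have "(C_mat K * C_mat_inv K) $$ (i, j) = 2 / of_nat (2 * j + 1) *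
      (\<Sum>l<M.
        of_nat (((2 * M - 2 * i) choose (2 * l + 1)) + ((2 * M - 2 * i) choose (2 * M - 2 * l)))
        * bernoulli_conv (2 * M + 1) (2 * j) (2 * l + 1))"
    unfolding sum_distrib_left atLeast0LessThan [symmetric]
    using ij by (auto simp: K C_mat_def C_mat_inv_def scalar_prod_def intro!: sum.cong)
  also have "\<dots> = (if i = j then 1 else 0)"
    using ij by (subst bernoulli_conv_orthogonality) (auto simp: K)
  finally show "(C_mat K * C_mat_inv K) $$ (i, j) = 1\<^sub>m (K - 1) $$ (i, j)"
    using ij by simp
qed (simp_all add: C_mat_def C_mat_inv_def)

lemma inverts_mat_C_mat: "inverts_mat (C_mat K) (C_mat_inv K)"
  using C_mat_mult_C_mat_inv by (simp add: inverts_mat_def C_mat_def)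

lemma inverts_mat_C_mat_inv: "inverts_mat (C_mat_inv K) (C_mat K)"
  using mat_mult_left_right_inverse [OF C_mat_carrier C_mat_inv_carrier C_mat_mult_C_mat_inv]
  by (simp add: inverts_mat_def C_mat_inv_def)

lemma invertible_C_mat: "invertible_mat (C_mat K)"
  using inverts_mat_C_mat inverts_mat_C_mat_inv C_mat_carrier [of K]
  by (auto simp: invertible_mat_def)

lemma inverts_mat_C_mat_unique:
  assumes "inverts_mat (C_mat K) D" "inverts_mat D (C_mat K)"
  shows "D = C_mat_inv K"
  by (rule inverts_mat_unique [OF C_mat_carrier C_mat_inv_carrier inverts_mat_C_mat_inv assms])

lemma C_mat_inv_index_bernoulli_conv:
  assumes "r \<in> {1..K - 1}" "s \<in> {1..K - 1}"
  shows "C_mat_inv K $$ (r - 1, s - 1)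
    = 2 / of_nat (2 * s - 1) * bernoulli_conv (2 * K - 1) (2 * s - 2) (2 * r - 1)"
proof -
  have "2 * (s - 1) + 1 = 2 * s - 1" "2 * (s - 1) = 2 * s - 2" "2 * (r - 1) + 1 = 2 * r - 1"
    "r - 1 < K - 1" "s - 1 < K - 1"
    using assms by auto
  then show ?thesis
    unfolding C_mat_inv_def by (simp only: index_mat prod.case)
qed

lemma C_mat_inv_index_bernoulli_conv_reflect:
  assumes "r \<in> {1..K - 1}" "s \<in> {1..K - 1}"
  shows "C_mat_inv K $$ (r - 1, s - 1)
    = - 2 / of_nat (2 * s - 1) * bernoulli_conv (2 * K - 1) (2 * s - 2) (2 * K - 2 * r)"
proof -
  have "bernoulli_conv (2 * K - 1) (2 * s - 2) (2 * K - 1 - (2 * r - 1))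
      = - bernoulli_conv (2 * K - 1) (2 * s - 2) (2 * r - 1)"
    using assms by (intro bernoulli_conv_reflect) auto
  moreover have "2 * K - 1 - (2 * r - 1) = 2 * K - 2 * r"
    using assms by auto
  ultimately show ?thesis
    unfolding C_mat_inv_index_bernoulli_conv [OF assms] by simp
qed

lemma C_mat_inv_index:
  assumes "k = 2 * K + 1" and "r \<in> {1..K - 1}" "s \<in> {1..K - 1}"
  shows "C_mat_inv K $$ (r - 1, s - 1) = 2 / of_nat (2 * s - 1) *
    (\<Sum>n = 0..k - 2 * s. of_nat ((2 * r - 1) choose (k - 2 * s - n)) *
       of_nat ((n + 2 * s - 2) choose n) * bernoulli n)"
  unfolding C_mat_inv_index_bernoulli_conv [OF assms(2,3)]
  using assms by (subst bernoulli_conv_eq_sum) auto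

lemma C_mat_inv_index_reflect:
  assumes "k = 2 * K + 1" and "r \<in> {1..K - 1}" "s \<in> {1..K - 1}"
  shows "C_mat_inv K $$ (r - 1, s - 1) = - 2 / of_nat (2 * s - 1) *
    (\<Sum>n = 0..k - 2 * s. of_nat ((k - 2 * r - 1) choose (k - 2 * s - n)) *
       of_nat ((n + 2 * s - 2) choose n) * bernoulli n)"
  unfolding C_mat_inv_index_bernoulli_conv_reflect [OF assms(2,3)]
  using assms by (subst bernoulli_conv_eq_sum) auto

theorem theorem1:
  fixes k K :: nat
  assumes "k = 2 * K + 1" and "k \<ge> 5"
  shows "invertible_mat (C_mat K) \<and>
    (\<forall>D. inverts_mat (C_mat K) D \<and> inverts_mat D (C_mat K) \<longrightarrow>
      (\<forall>r\<in>{1..K - 1}. \<forall>s\<in>{1..K - 1}.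
        D $$ (r - 1, s - 1) =
          - 2 / of_nat (2 * s - 1) *
            (\<Sum>n = 0..k - 2 * s. of_nat ((k - 2 * r - 1) choose (k - 2 * s - n)) *
               of_nat ((n + 2 * s - 2) choose n) * bernoulli n) \<and>
        D $$ (r - 1, s - 1) =
          2 / of_nat (2 * s - 1) *
            (\<Sum>n = 0..k - 2 * s. of_nat ((2 * r - 1) choose (k - 2 * s - n)) *
               of_nat ((n + 2 * s - 2) choose n) * bernoulli n)))"
proof (intro conjI allI impI ballI)
  show "invertible_mat (C_mat K)"
    by (rule invertible_C_mat)
next
  fix D r s
  assume "inverts_mat (C_mat K) D \<and> inverts_mat D (C_mat K)"
    and rs: "r \<in> {1..K - 1}" "s \<in> {1..K - 1}"
  then have D: "D = C_mat_inv K"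
    by (blast intro: inverts_mat_C_mat_unique)
  show "D $$ (r - 1, s - 1) = - 2 / of_nat (2 * s - 1) *
      (\<Sum>n = 0..k - 2 * s. of_nat ((k - 2 * r - 1) choose (k - 2 * s - n)) *
         of_nat ((n + 2 * s - 2) choose n) * bernoulli n)"
    unfolding D by (rule C_mat_inv_index_reflect [OF assms(1) rs])
  show "D $$ (r - 1, s - 1) = 2 / of_nat (2 * s - 1) *
      (\<Sum>n = 0..k - 2 * s. of_nat ((2 * r - 1) choose (k - 2 * s - n)) *
         of_nat ((n + 2 * s - 2) choose n) * bernoulli n)"
    unfolding D by (rule C_mat_inv_index [OF assms(1) rs])
qed

end
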